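(* Let $(Z_t,X_t)_{t\ge 1}$ be the univariate discrete-time marked Hawkes process with base intensity $\nu>0$, exciting function $\alpha$ and i.i.d. positive marks $\ell_{t,j}$, with $\Vert\alpha\Vert_1\mathbb{E}[\ell_{1,1}]<1$ (as defined in the context), and let $L_t=\sum_{s=1}^{t}X_s$. Assume that the first four moments of $\ell_{t,j}$ are finite and that $$\lim_{t\to\infty}\frac{1}{\sqrt{t}}\sum_{u=1}^{t-1}\sum_{s=1+u}^{\infty}\alpha(s)=0.$$ Then $$\frac{1}{\sqrt{t}}\left(L_t-\frac{\nu\,\mathbb{E}[\ell_{1,1}]\,t}{1-\Vert\alpha\Vert_1\mathbb{E}[\ell_{1,1}]}\right)\longrightarrow N\left(0,\frac{\nu\,\mathbb{E}[\ell_{1,1}^2]}{(1-\Vert\alpha\Vert_1\mathbb{E}[\ell_{1,1}])^3}\right)$$ in distribution as $t\to\infty$, where $N(0,\sigma^2)$ denotes the normal distribution with mean $0$ and variance $\sigma^2$.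
   Context: Univariate discrete-time marked Hawkes process. Let $\nu>0$, let $\alpha:\mathbb{N}\cup\{0\}\to\mathbb{R}_+$ be a positive function, and put $\Vert\alpha\Vert_1:=\sum_{t=1}^{\infty}\alpha(t)$. Let $(\ell_{t,j})_{t\ge1,\,j\ge1}$ be positive random variables, i.i.d. in both $t$ and $j$, with finite mean. Set $X_0=N_0=0$. For $t\ge1$ let $$\lambda_t:=\nu+\sum_{s=1}^{t-1}\alpha(s)X_{t-s}$$ (so $\lambda_1=\nu$). Let $\mathcal{F}_t=\sigma(Z_s,X_s:1\le s\le t)$ be the natural filtration, with $\mathcal{F}_0$ trivial. Conditionally on $\mathcal{F}_{t-1}$, $Z_t$ is a Poisson random variable with mean $\lambda_t$, and $$X_t:=\sum_{j=1}^{Z_t}\ell_{t,j},$$ where the marks $(\ell_{t,j})_{j\ge1}$ at time $t$ are independent of $\sigma(\mathcal{F}_{t-1},Z_t)$. Standing assumption: $\Vert\alpha\Vert_1\mathbb{E}[\ell_{1,1}]<1$. Define $N_t:=\sum_{s=1}^tZ_s$ and $L_t:=\sum_{s=1}^tX_s$. *)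

theory Defs
  imports "HOL-Probability.Probability"
begin

definition intensity ::
    "real \<Rightarrow> (nat \<Rightarrow> real) \<Rightarrow> (nat \<Rightarrow> 'a \<Rightarrow> real) \<Rightarrow> nat \<Rightarrow> 'a \<Rightarrow> real" where
  "intensity \<nu> \<alpha> X t \<omega> = \<nu> + (\<Sum>s = 1..<t. \<alpha> s * X (t - s) \<omega>)"

(* F_t; for t = 0 the generating family is empty, so F_0 is trivial. *)
definition history ::
    "'a measure \<Rightarrow> (nat \<Rightarrow> 'a \<Rightarrow> nat) \<Rightarrow> (nat \<Rightarrow> 'a \<Rightarrow> real) \<Rightarrow> nat \<Rightarrow> 'a measure" where
  "history M Z X t = sigma (space M)
     (\<Union>s\<in>{1..t}. sets (vimage_algebra (space M) (Z s) (count_space UNIV)) \<union>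
                  sets (vimage_algebra (space M) (X s) borel))"

(* The norm of the exciting function starts at lag 1: the value at 0 is not part of it. *)
definition exciting_norm :: "(nat \<Rightarrow> real) \<Rightarrow> real" where
  "exciting_norm \<alpha> = (\<Sum>t. \<alpha> (Suc t))"

(* The marks l t j and the counts Z t are used for t, j >= 1 only. *)
locale marked_hawkes = prob_space M
  for M :: "'a measure" +
  fixes \<nu> :: real
    and \<alpha> :: "nat \<Rightarrow> real"
    and l :: "nat \<Rightarrow> nat \<Rightarrow> 'a \<Rightarrow> real"
    and Z :: "nat \<Rightarrow> 'a \<Rightarrow> nat"
    and X :: "nat \<Rightarrow> 'a \<Rightarrow> real"
  assumes base_pos: "0 < \<nu>"
    and exciting_pos: "\<And>t. 0 < \<alpha> t"
    and marks_indep: "indep_vars (\<lambda>_. borel) (\<lambda>(t, j). l t j) ({1..} \<times> {1..})"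
    and marks_identical:
      "\<And>t j. 1 \<le> t \<Longrightarrow> 1 \<le> j \<Longrightarrow> distr M borel (l t j) = distr M borel (l 1 1)"
    and marks_pos: "\<And>t j. 1 \<le> t \<Longrightarrow> 1 \<le> j \<Longrightarrow> AE \<omega> in M. 0 < l t j \<omega>"
    and marks_integrable: "\<And>t j. 1 \<le> t \<Longrightarrow> 1 \<le> j \<Longrightarrow> integrable M (l t j)"
    and counts_measurable: "\<And>t. 1 \<le> t \<Longrightarrow> random_variable (count_space UNIV) (Z t)"
    and X_0: "\<And>\<omega>. \<omega> \<in> space M \<Longrightarrow> X 0 \<omega> = 0"
    and X_eq: "\<And>t \<omega>. 1 \<le> t \<Longrightarrow> \<omega> \<in> space M \<Longrightarrow> X t \<omega> = (\<Sum>j = 1..Z t \<omega>. l t j \<omega>)"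
    and counts_poisson:
      "\<And>t n. 1 \<le> t \<Longrightarrow>
         AE \<omega> in M. real_cond_exp M (history M Z X (t - 1)) (indicator {\<omega> \<in> space M. Z t \<omega> = n}) \<omega>
                   = pmf (poisson_pmf (intensity \<nu> \<alpha> X t \<omega>)) n"
    and marks_indep_past:
      "\<And>t. 1 \<le> t \<Longrightarrow>
         indep_set
           (sigma_sets (space M) (sets (history M Z X (t - 1)) \<union>
              sets (vimage_algebra (space M) (Z t) (count_space UNIV))))
           (sigma_sets (space M) (\<Union>j\<in>{1..}. sets (vimage_algebra (space M) (l t j) borel)))"

definition cumulative_marks :: "(nat \<Rightarrow> 'a \<Rightarrow> real) \<Rightarrow> nat \<Rightarrow> 'a \<Rightarrow> real" where
  "cumulative_marks X t \<omega> = (\<Sum>s = 1..t. X s \<omega>)"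

end

theory Submission
  imports Defs "HOL-Real_Asymp.Real_Asymp"
begin

text \<open>
  No martingale limit theorem is needed, because the process is affine: given the past,
  \<open>X\<^sub>t\<close> is compound Poisson with a rate that is linear in the earlier \<open>X\<^sub>s\<close>.
  Write \<open>\<Phi>(z)\<close> for the expectation of \<open>exp (z l)\<close>, where \<open>Re z \<le> 0\<close>. Integrating out
  the steps \<open>t, t - 1, \<dots>, 1\<close> one by one gives the exact formula
  \<open>E exp (w L\<^sub>t) = exp (\<nu> \<Sum>n<t. \<Phi>(G n) - 1)\<close> with
  \<open>G n = w + (\<Sum>j<n. \<alpha>(n - j) (\<Phi>(G j) - 1))\<close>.
  For \<open>w = \<i> \<theta> / \<surd>t\<close>, the sequence \<open>G\<close> is of order \<open>1 / \<surd>t\<close> and, because \<open>\<Vert>\<alpha>\<Vert> E l < 1\<close>,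
  close to \<open>w / (1 - \<Vert>\<alpha>\<Vert> E l)\<close> on average. A Taylor expansion of \<open>\<Phi>\<close> to second order then yields
  the Gaussian exponent; the tail condition makes the boundary error of the convolution
  vanish. Levy's continuity theorem concludes.
\<close>

section \<open>Asymptotics of the cumulant recursion\<close>

text \<open>The coefficient that \<open>X (t - n)\<close> carries when n later steps have been
  integrated out and its own turn comes; the horizon t has dropped out. The equation would loop as a
  simp rule, so it is unfolded only at chosen indices.\<close>

fun cumulant_seq :: "(nat \<Rightarrow> real) \<Rightarrow> (complex \<Rightarrow> complex) \<Rightarrow> complex \<Rightarrow> nat \<Rightarrow> complex" where
  "cumulant_seq \<alpha> \<Phi> w n = w + (\<Sum>j<n. of_real (\<alpha> (n - j)) * (\<Phi> (cumulant_seq \<alpha> \<Phi> w j) - 1))"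

declare cumulant_seq.simps [simp del]

section \<open>Convolution sums and tails of the exciting function\<close>

text \<open>Sums the triangle j < n < t by the lag k = n - j. In a summed renewal equation this
  turns the kernel into its mass up to the horizon.\<close>

lemma sum_convolution_swap:
  fixes f :: "nat \<Rightarrow> 'b::comm_ring_1"
  shows "(\<Sum>n<t. \<Sum>j<n. g (n - j) * f j) = (\<Sum>j<t. f j * (\<Sum>k=1..<t-j. g k))"
proof -
  have "(\<Sum>n<t. \<Sum>j<n. g (n - j) * f j) = (\<Sum>(n, j)\<in>Sigma {..<t} (\<lambda>n. {..<n}). g (n - j) * f j)"
    by (simp add: sum.Sigma)
  also have "\<dots> = (\<Sum>(j, k)\<in>Sigma {..<t} (\<lambda>j. {1..<t-j}). f j * g k)"
    by (rule sum.reindex_bij_witness[where j = "\<lambda>(n, j). (j, n - j)" and i = "\<lambda>(j, k). (j + k, j)"])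
       (auto simp: mult.commute)
  also have "\<dots> = (\<Sum>j<t. f j * (\<Sum>k=1..<t-j. g k))"
    by (simp add: sum.Sigma[symmetric] sum_distrib_left)
  finally show ?thesis .
qed

text \<open>Mass of the lags beyond n, indexed so that it unfolds literally to the inner series of
  the tail hypothesis.\<close>

definition exciting_tail :: "(nat \<Rightarrow> real) \<Rightarrow> nat \<Rightarrow> real" where
  "exciting_tail \<alpha> n = (\<Sum>s. \<alpha> (s + (1 + n)))"

lemma sum_exciting:
  assumes "summable \<alpha>"
  shows "(\<Sum>k=1..<Suc n. \<alpha> k) = exciting_norm \<alpha> - exciting_tail \<alpha> n"
proof -
  have "summable (\<lambda>s. \<alpha> (Suc s))" using assms by (simp add: summable_Suc_iff)
  from suminf_split_initial_segment[OF this, of n]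
  have "exciting_norm \<alpha> = exciting_tail \<alpha> n + (\<Sum>i<n. \<alpha> (Suc i))"
    by (simp add: exciting_norm_def exciting_tail_def)
  also have "(\<Sum>i<n. \<alpha> (Suc i)) = (\<Sum>k=1..<Suc n. \<alpha> k)"
    by (simp add: sum.shift_bounds_Suc_ivl lessThan_atLeast0 del: sum.op_ivl_Suc)
  finally show ?thesis by simp
qed

lemma exciting_tail_nonneg:
  assumes "summable \<alpha>" "\<And>t. 0 \<le> \<alpha> t"
  shows "0 \<le> exciting_tail \<alpha> n"
  unfolding exciting_tail_def
  by (rule suminf_nonneg) (use assms in \<open>simp_all add: summable_iff_shift[of \<alpha> "Suc n", simplified]\<close>)

lemma exciting_norm_nonneg:
  assumes "summable \<alpha>" "\<And>t. 0 \<le> \<alpha> t"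
  shows "0 \<le> exciting_norm \<alpha>"
  using exciting_tail_nonneg[OF assms, of 0] by (simp add: exciting_norm_def exciting_tail_def)

text \<open>The factorisation (x + y) (x - y) lets the summed deviations of the recursion from its
  limit control those of the squares.\<close>

lemma norm_minus_complex_square_le:
  fixes x y :: complex
  assumes "norm x \<le> K" "norm y \<le> K"
  shows "norm (x\<^sup>2 - y\<^sup>2) \<le> 2 * K * norm (x - y)"
proof -
  have "norm (x\<^sup>2 - y\<^sup>2) = norm (x + y) * norm (x - y)"
    by (simp add: norm_mult[symmetric] power2_eq_square algebra_simps)
  also have "norm (x + y) \<le> 2 * K" using norm_triangle_ineq[of x y] assms by simp
  finally show ?thesis by (simp add: mult_right_mono)
qed

section \<open>A priori bounds and average deviation for the recursion\<close>

text \<open>What the deterministic analysis takes from the mark law. \<open>Re_\<Phi>\<close> keeps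
  the recursion in the left half-plane; the other bounds are Taylor expansions at 0, in which
  \<open>m\<^sub>1\<close> and \<open>m\<^sub>2\<close> act both as moments and as remainder
  constants.\<close>

locale cumulant_recursion =
  fixes \<alpha> :: "nat \<Rightarrow> real" and \<Phi> :: "complex \<Rightarrow> complex" and m\<^sub>1 m\<^sub>2 m\<^sub>3 :: real
  assumes summable: "summable \<alpha>"
    and nonneg: "\<And>t. 0 \<le> \<alpha> t"
    and m1: "0 \<le> m\<^sub>1" and m2: "0 \<le> m\<^sub>2" and m3: "0 \<le> m\<^sub>3"
    and subcritical: "exciting_norm \<alpha> * m\<^sub>1 < 1"
    and Re_\<Phi>: "\<And>z::complex. Re z \<le> 0 \<Longrightarrow> Re (\<Phi> z) \<le> 1"
    and \<Phi>_1: "\<And>z::complex. Re z \<le> 0 \<Longrightarrow> norm (\<Phi> z - 1) \<le> m\<^sub>1 * norm z"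
    and \<Phi>_2: "\<And>z::complex. Re z \<le> 0 \<Longrightarrow> norm (\<Phi> z - 1 - m\<^sub>1 * z) \<le> m\<^sub>2 * norm z ^ 2"
    and \<Phi>_3: "\<And>z::complex. Re z \<le> 0 \<Longrightarrow> norm (\<Phi> z - 1 - m\<^sub>1 * z - m\<^sub>2 / 2 * z\<^sup>2) \<le> m\<^sub>3 * norm z ^ 3"
begin

abbreviation "a \<equiv> exciting_norm \<alpha>"
text \<open>The branching ratio: the mean number of events directly triggered by one event.\<close>

abbreviation "\<rho> \<equiv> a * m\<^sub>1"
abbreviation "T \<equiv> exciting_tail \<alpha>"
abbreviation "G \<equiv> cumulant_seq \<alpha> \<Phi>"
abbreviation "D w n \<equiv> \<Phi> (G w n) - 1"

text \<open>From time j only the lags 1, ..., t - 1 - j stay below the horizon t; the missing mass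
  is the boundary effect that the tail hypothesis controls.\<close>

lemma sum_lag: "j < t \<Longrightarrow> (\<Sum>k=1..<t-j. \<alpha> k) = a - T (t - Suc j)"
  using sum_exciting[OF summable, of "t - Suc j"] by (simp add: Suc_diff_Suc del: sum.op_ivl_Suc)

lemma sum_lag_le: "(\<Sum>k=1..<n. \<alpha> k) \<le> a"
  using sum_exciting[OF summable, of "n - 1"] exciting_tail_nonneg[OF summable nonneg, of "n - 1"]
    exciting_norm_nonneg[OF summable nonneg]
  by (cases n) (simp_all del: sum.op_ivl_Suc)

lemma sum_lag_rev: "(\<Sum>j<n. \<alpha> (n - j)) = a - T n"
proof -
  have "(\<Sum>j<n. \<alpha> (n - j)) = (\<Sum>k=1..<Suc n. \<alpha> k)"
    by (rule sum.reindex_bij_witness[where i = "\<lambda>k. n - k" and j = "\<lambda>j. n - j"]) auto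
  then show ?thesis using sum_exciting[OF summable] by metis
qed

text \<open>The weights are nonnegative and \<Phi> - 1 has nonpositive real part on the half-plane,
  so the recursion never leaves the region where the bounds on \<Phi> hold.\<close>

lemma Re_G:
  assumes "Re w \<le> 0"
  shows "Re (G w n) \<le> 0"
proof (induction n rule: less_induct)
  case (less n)
  have "(\<Sum>j<n. Re (of_real (\<alpha> (n - j)) * D w j)) \<le> 0"
    by (rule sum_nonpos) (use less Re_\<Phi> nonneg in \<open>auto simp: mult_nonneg_nonpos\<close>)
  then show ?case using assms by (simp add: cumulant_seq.simps[of _ _ _ n])
qed

text \<open>The bound K = |w| / (1 - \<rho>) solves K = |w| + \<rho> K, hence reproduces itself
  along the recursion.\<close>

lemma norm_G:
  assumes w: "Re w \<le> 0"
  shows "norm (G w n) \<le> norm w / (1 - \<rho>)"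
proof (induction n rule: less_induct)
  case (less n)
  let ?K = "norm w / (1 - \<rho>)"
  have K: "0 \<le> ?K" using subcritical by simp
  have "norm (G w n) \<le> norm w + (\<Sum>j<n. norm (of_real (\<alpha> (n - j)) * D w j))"
    unfolding cumulant_seq.simps[of _ _ _ n]
    by (rule norm_triangle_le) (simp add: norm_sum)
  also have "(\<Sum>j<n. norm (of_real (\<alpha> (n - j)) * D w j)) \<le> (\<Sum>j<n. \<alpha> (n - j) * (m\<^sub>1 * ?K))"
  proof (rule sum_mono)
    fix j assume "j \<in> {..<n}"
    then have "m\<^sub>1 * norm (G w j) \<le> m\<^sub>1 * ?K" using less m1 by (intro mult_left_mono) auto
    then have "norm (D w j) \<le> m\<^sub>1 * ?K" using \<Phi>_1[OF Re_G[OF w, of j]] by linarith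
    then show "norm (of_real (\<alpha> (n - j)) * D w j) \<le> \<alpha> (n - j) * (m\<^sub>1 * ?K)"
      using nonneg by (simp only: norm_mult norm_of_real abs_of_nonneg mult_left_mono)
  qed
  also have "\<dots> = (a - T n) * (m\<^sub>1 * ?K)"
    by (simp only: sum_lag_rev sum_distrib_right[symmetric])
  also have "\<dots> \<le> a * (m\<^sub>1 * ?K)"
    using exciting_tail_nonneg[OF summable nonneg, of n] m1 K by (intro mult_right_mono mult_nonneg_nonneg) simp_all
  finally have "norm (G w n) \<le> norm w + \<rho> * ?K" by (simp add: mult.assoc)
  also have "\<dots> = ?K" using subcritical by (simp add: field_simps)
  finally show ?case .
qed

lemma norm_D:
  assumes "Re w \<le> 0"
  shows "norm (D w n) \<le> m\<^sub>1 * (norm w / (1 - \<rho>))"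
  using \<Phi>_1[OF Re_G[OF assms, of n]] mult_left_mono[OF norm_G[OF assms, of n] m1] by linarith

text \<open>To first order \<^term>\<open>G w\<close> solves a linear renewal equation whose limit is
  \<open>w / (1 - \<rho>)\<close>; this is the contracting inequality for the distance to that limit.\<close>
lemma deviation_step:
  fixes w :: complex
  assumes w: "Re w \<le> 0"
  defines "K \<equiv> norm w / (1 - \<rho>)" and "e \<equiv> \<lambda>n. norm (G w n - w / (1 - \<rho>))"
  shows "e n \<le> (\<Sum>j<n. \<alpha> (n - j) * (m\<^sub>1 * e j + m\<^sub>2 * K\<^sup>2)) + m\<^sub>1 * K * T n"
proof -
  define v where "v = w / complex_of_real (1 - \<rho>)"
  have nz: "complex_of_real (1 - \<rho>) \<noteq> 0" using subcritical by (simp only: of_real_eq_0_iff)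
  have "w = of_real (1 - \<rho>) * v" using nz by (simp add: v_def del: of_real_diff)
  then have v: "w - v = - of_real \<rho> * v" by (simp add: algebra_simps)
  \<comment> \<open>Splitting the mass a inside \<rho> v at lag n centres each \<open>D w j\<close>
    at its first-order limit \<open>m\<^sub>1 * v\<close>; the lags beyond n leave the tail
    term.\<close>
  have lag: "complex_of_real a = (\<Sum>j<n. of_real (\<alpha> (n - j))) + of_real (T n)"
    by (simp only: of_real_sum[symmetric] sum_lag_rev) simp
  have "G w n - v = (\<Sum>j<n. of_real (\<alpha> (n - j)) * D w j) - of_real \<rho> * v"
    using v by (simp add: cumulant_seq.simps[of _ _ _ n] algebra_simps)
  also have "\<dots> = (\<Sum>j<n. of_real (\<alpha> (n - j)) * (D w j - m\<^sub>1 * v)) - of_real (m\<^sub>1 * T n) * v"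
    by (simp add: lag algebra_simps sum_subtractf sum.distrib sum_distrib_left sum_distrib_right)
  finally have eq: "G w n - v = \<dots>" .
  have "e n \<le> (\<Sum>j<n. norm (of_real (\<alpha> (n - j)) * (D w j - m\<^sub>1 * v))) + norm (of_real (m\<^sub>1 * T n) * v)"
    unfolding e_def v_def[symmetric] eq by (rule order_trans[OF norm_triangle_ineq4]) (simp only: add_right_mono norm_sum)
  also have "norm (of_real (m\<^sub>1 * T n) * v) = m\<^sub>1 * K * T n"
    using m1 exciting_tail_nonneg[OF summable nonneg, of n] subcritical
    by (simp add: norm_mult norm_divide K_def v_def del: of_real_diff of_real_mult)
  also have "(\<Sum>j<n. norm (of_real (\<alpha> (n - j)) * (D w j - m\<^sub>1 * v)))
      \<le> (\<Sum>j<n. \<alpha> (n - j) * (m\<^sub>1 * e j + m\<^sub>2 * K\<^sup>2))"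
  proof (rule sum_mono)
    fix j assume "j \<in> {..<n}"
    have "norm (D w j - m\<^sub>1 * v) \<le> norm (D w j - m\<^sub>1 * G w j) + norm (m\<^sub>1 * (G w j - v))"
      using norm_triangle_ineq[of "D w j - m\<^sub>1 * G w j" "m\<^sub>1 * (G w j - v)"]
      by (simp add: algebra_simps)
    also have "norm (m\<^sub>1 * (G w j - v)) = m\<^sub>1 * e j" using m1 by (simp add: norm_mult e_def v_def)
    also have "norm (D w j - m\<^sub>1 * G w j) \<le> m\<^sub>2 * K\<^sup>2"
      using \<Phi>_2[OF Re_G[OF w, of j]]
        mult_left_mono[OF power_mono[OF norm_G[OF w, of j] norm_ge_zero, of 2] m2]
      unfolding K_def by linarith
    finally show "norm (of_real (\<alpha> (n - j)) * (D w j - m\<^sub>1 * v)) \<le> \<alpha> (n - j) * (m\<^sub>1 * e j + m\<^sub>2 * K\<^sup>2)"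
      using nonneg by (simp add: norm_mult mult_left_mono)
  qed
  finally show ?thesis by simp
qed

text \<open>Summation turns the kernel into a factor of at most a, so the sum of deviations
  reappears on the right with factor \<rho> < 1 and is absorbed. For K of order 1 / sqrt t and tail
  sums of order sqrt t the total deviation stays bounded.\<close>

lemma sum_deviation:
  fixes w :: complex
  assumes w: "Re w \<le> 0"
  defines "K \<equiv> norm w / (1 - \<rho>)"
  shows "(\<Sum>n<t. norm (G w n - w / (1 - \<rho>)))
    \<le> (t * a * m\<^sub>2 * K\<^sup>2 + m\<^sub>1 * K * (\<Sum>n<t. T n)) / (1 - \<rho>)"
proof -
  define e where "e n = norm (G w n - w / (1 - \<rho>))" for n
  have "(\<Sum>n<t. e n) \<le> (\<Sum>n<t. (\<Sum>j<n. \<alpha> (n - j) * (m\<^sub>1 * e j + m\<^sub>2 * K\<^sup>2)) + m\<^sub>1 * K * T n)"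
    using deviation_step[OF w] unfolding e_def K_def by (intro sum_mono) simp
  also have "\<dots> = (\<Sum>j<t. (m\<^sub>1 * e j + m\<^sub>2 * K\<^sup>2) * (\<Sum>k=1..<t-j. \<alpha> k)) + m\<^sub>1 * K * (\<Sum>n<t. T n)"
    by (simp only: sum.distrib sum_convolution_swap[of \<alpha> "\<lambda>j. m\<^sub>1 * e j + m\<^sub>2 * K\<^sup>2"] sum_distrib_left[symmetric])
  also have "(\<Sum>j<t. (m\<^sub>1 * e j + m\<^sub>2 * K\<^sup>2) * (\<Sum>k=1..<t-j. \<alpha> k)) \<le> (\<Sum>j<t. (m\<^sub>1 * e j + m\<^sub>2 * K\<^sup>2) * a)"
    by (intro sum_mono mult_left_mono sum_lag_le) (use m1 m2 in \<open>simp add: e_def\<close>)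
  also have "\<dots> = \<rho> * (\<Sum>j<t. e j) + t * a * m\<^sub>2 * K\<^sup>2"
    by (simp add: sum_distrib_right[symmetric] sum.distrib sum_distrib_left[symmetric] algebra_simps)
  finally have "(1 - \<rho>) * (\<Sum>n<t. e n) \<le> t * a * m\<^sub>2 * K\<^sup>2 + m\<^sub>1 * K * (\<Sum>n<t. T n)"
    by (simp add: algebra_simps)
  then show ?thesis using subcritical by (simp add: e_def pos_le_divide_eq mult.commute)
qed

section \<open>Second-order expansion and the Gaussian exponent\<close>

text \<open>The recursion expresses the sum of G through the sum of D, and the Taylor expansion of
  \<Phi> expresses the sum of D through that of G. Eliminating the sum of G leaves the factor 1 -
  \<rho> in front of the sum of D.\<close>

lemma cumulant_expansion:
  fixes w :: complex
  assumes w: "Re w \<le> 0"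
  defines "K \<equiv> norm w / (1 - \<rho>)"
  shows "norm ((1 - \<rho>) * (\<Sum>n<t. D w n) - t * (m\<^sub>1 * w) - m\<^sub>2 / 2 * (t * (w / (1 - \<rho>))\<^sup>2))
    \<le> m\<^sub>1 * (m\<^sub>1 * K * (\<Sum>n<t. T n))
      + m\<^sub>2 * K * ((t * a * m\<^sub>2 * K\<^sup>2 + m\<^sub>1 * K * (\<Sum>n<t. T n)) / (1 - \<rho>)) + t * (m\<^sub>3 * K ^ 3)"
proof -
  let ?v = "w / complex_of_real (1 - \<rho>)"
  \<comment> \<open>The three errors: Q collects the lags cut off by the horizon, P the replacement
    of \<open>G w n\<close> by its limit \<open>?v\<close> in the quadratic term, R the third-order
    Taylor remainders.\<close>
  define Q where "Q = (\<Sum>j<t. D w j * of_real (T (t - Suc j)))"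
  define P where "P = (\<Sum>n<t. (G w n)\<^sup>2 - ?v\<^sup>2)"
  define R where "R = (\<Sum>n<t. D w n - m\<^sub>1 * G w n - m\<^sub>2 / 2 * (G w n)\<^sup>2)"
  have K: "0 \<le> K" using subcritical by (simp add: K_def)
  have G: "norm (G w n) \<le> K" for n using norm_G[OF w] by (simp add: K_def)
  have v: "norm ?v \<le> K" using subcritical by (simp add: K_def norm_divide del: of_real_diff)
  have sumG: "(\<Sum>n<t. G w n) = t * w + a * (\<Sum>j<t. D w j) - Q"
  proof -
    have "(\<Sum>n<t. G w n) = (\<Sum>n<t. w + (\<Sum>j<n. of_real (\<alpha> (n - j)) * D w j))"
      by (rule sum.cong[OF refl]) (rule cumulant_seq.simps)
    also have "\<dots> = t * w + (\<Sum>j<t. D w j * (\<Sum>k=1..<t-j. of_real (\<alpha> k)))"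
      by (simp add: sum.distrib sum_convolution_swap[of "\<lambda>k. of_real (\<alpha> k)" "D w"])
    also have "(\<Sum>j<t. D w j * (\<Sum>k=1..<t-j. of_real (\<alpha> k))) = (\<Sum>j<t. D w j * of_real (a - T (t - Suc j)))"
      by (rule sum.cong) (simp_all only: of_real_sum[symmetric] sum_lag lessThan_iff)
    also have "\<dots> = a * (\<Sum>j<t. D w j) - Q"
      by (simp add: Q_def algebra_simps sum_subtractf sum.distrib sum_distrib_left)
    finally show ?thesis by simp
  qed
  have sumD: "(\<Sum>n<t. D w n) = m\<^sub>1 * (\<Sum>n<t. G w n) + m\<^sub>2 / 2 * (P + t * ?v\<^sup>2) + R"
    by (simp add: P_def R_def sum_subtractf sum.distrib sum_distrib_left sum_divide_distrib algebra_simps)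
  have "(1 - \<rho>) * (\<Sum>n<t. D w n) - t * (m\<^sub>1 * w) - m\<^sub>2 / 2 * (t * (w / (1 - \<rho>))\<^sup>2)
      = m\<^sub>2 / 2 * P + R - m\<^sub>1 * Q"
    using sumD unfolding sumG by (simp add: algebra_simps)
  then have "norm ((1 - \<rho>) * (\<Sum>n<t. D w n) - t * (m\<^sub>1 * w) - m\<^sub>2 / 2 * (t * (w / (1 - \<rho>))\<^sup>2))
      \<le> norm (m\<^sub>2 / 2 * P) + norm R + norm (m\<^sub>1 * Q)"
    using norm_triangle_ineq4[of "m\<^sub>2 / 2 * P + R" "m\<^sub>1 * Q"] norm_triangle_ineq[of "m\<^sub>2 / 2 * P" R]
    by simp
  moreover have "norm (m\<^sub>1 * Q) \<le> m\<^sub>1 * (m\<^sub>1 * K * (\<Sum>n<t. T n))"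
  proof -
    have "norm Q \<le> (\<Sum>j<t. m\<^sub>1 * K * T (t - Suc j))"
      unfolding Q_def
      by (rule order_trans[OF norm_sum], rule sum_mono)
         (use norm_D[OF w] exciting_tail_nonneg[OF summable nonneg] in
           \<open>simp only: norm_mult norm_of_real abs_of_nonneg K_def mult_right_mono\<close>)
    also have "\<dots> = m\<^sub>1 * K * (\<Sum>n<t. T n)"
      by (simp only: sum_distrib_left sum.nat_diff_reindex[of "\<lambda>j. m\<^sub>1 * K * T j"])
    finally show ?thesis using m1 by (simp add: norm_mult mult_left_mono)
  qed
  moreover have "norm R \<le> t * (m\<^sub>3 * K ^ 3)"
  proof -
    have "norm R \<le> (\<Sum>n<t. m\<^sub>3 * K ^ 3)"
      unfolding R_def
    proof (rule order_trans[OF norm_sum], rule sum_mono)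
      fix n
      show "norm (D w n - m\<^sub>1 * G w n - m\<^sub>2 / 2 * (G w n)\<^sup>2) \<le> m\<^sub>3 * K ^ 3"
        using \<Phi>_3[OF Re_G[OF w, of n]] mult_left_mono[OF power_mono[OF G[of n] norm_ge_zero, of 3] m3]
        by linarith
    qed
    then show ?thesis by simp
  qed
  moreover have "norm (m\<^sub>2 / 2 * P) \<le> m\<^sub>2 * K * ((t * a * m\<^sub>2 * K\<^sup>2 + m\<^sub>1 * K * (\<Sum>n<t. T n)) / (1 - \<rho>))"
  proof -
    have "norm P \<le> (\<Sum>n<t. 2 * K * norm (G w n - ?v))"
      unfolding P_def
      by (rule order_trans[OF norm_sum], rule sum_mono) (rule norm_minus_complex_square_le[OF G v])
    also have "\<dots> \<le> 2 * K * ((t * a * m\<^sub>2 * K\<^sup>2 + m\<^sub>1 * K * (\<Sum>n<t. T n)) / (1 - \<rho>))"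
      unfolding sum_distrib_left[symmetric]
      using sum_deviation[OF w, of t] K by (intro mult_left_mono) (simp_all add: K_def)
    finally have "m\<^sub>2 / 2 * norm P \<le> m\<^sub>2 / 2 * (2 * K * ((t * a * m\<^sub>2 * K\<^sup>2 + m\<^sub>1 * K * (\<Sum>n<t. T n)) / (1 - \<rho>)))"
      using m2 by (intro mult_left_mono) auto
    then show ?thesis using m2 by (simp add: norm_mult norm_divide mult.assoc)
  qed
  ultimately show ?thesis by linarith
qed

text \<open>Here \<open>t * (w t)\<^sup>2\<close> is the constant -\<theta>^2, which gives the
  Gaussian exponent. With K = C / sqrt t the boundary error is of the order of the normalised tail
  sum, and the other errors carry a further factor 1 / sqrt t.\<close>

lemma cumulant_limit:
  fixes w :: "nat \<Rightarrow> complex" and \<theta> :: real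
  assumes tail: "(\<lambda>t. 1 / sqrt (real t) * (\<Sum>u = 1..<t. T u)) \<longlonglongrightarrow> 0"
  defines "w \<equiv> \<lambda>t. \<i> * complex_of_real (\<theta> / sqrt (real t))"
  shows "(\<lambda>t. (\<Sum>n<t. D (w t) n) - t * (m\<^sub>1 * w t) / (1 - \<rho>))
    \<longlonglongrightarrow> of_real (- (m\<^sub>2 * \<theta>\<^sup>2 / (2 * (1 - \<rho>) ^ 3)))"
proof -
  define C where "C = \<bar>\<theta>\<bar> / (1 - \<rho>)"
  define \<tau> where "\<tau> t = (\<Sum>n<t. T n) / sqrt (real t)" for t
  have inv: "(\<lambda>t. 1 / sqrt (real t)) \<longlonglongrightarrow> 0" by real_asymp
  \<comment> \<open>The hypothesis starts at u = 1, whereas the expansion also uses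
    \<open>T 0\<close>; that single term vanishes after division by sqrt t.\<close>
  have "(\<lambda>t. T 0 * (1 / sqrt (real t)) + 1 / sqrt (real t) * (\<Sum>u = 1..<t. T u)) \<longlonglongrightarrow> T 0 * 0 + 0"
    by (intro tendsto_intros inv tail)
  moreover have "eventually (\<lambda>t. T 0 * (1 / sqrt (real t)) + 1 / sqrt (real t) * (\<Sum>u = 1..<t. T u) = \<tau> t) sequentially"
    using eventually_gt_at_top[of 0]
  proof eventually_elim
    case (elim t)
    then have "(\<Sum>n<t. T n) = T 0 + (\<Sum>u = 1..<t. T u)"
      by (simp add: lessThan_atLeast0 sum.atLeast_Suc_lessThan)
    then show ?case by (simp add: \<tau>_def add_divide_distrib)
  qed
  ultimately have \<tau>: "\<tau> \<longlonglongrightarrow> 0" by (simp add: tendsto_cong)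
  \<comment> \<open>The right side of \<open>cumulant_expansion\<close> at K = C / sqrt t, with the
    sum of T written as \<open>\<tau> t * sqrt t\<close>.\<close>
  define B where "B t = m\<^sub>1 * (m\<^sub>1 * C * \<tau> t)
      + m\<^sub>2 * C * ((a * m\<^sub>2 * C\<^sup>2 * (1 / sqrt t) + m\<^sub>1 * C * \<tau> t * (1 / sqrt t)) / (1 - \<rho>)) + m\<^sub>3 * C ^ 3 * (1 / sqrt t)" for t :: nat
  have "B \<longlonglongrightarrow> m\<^sub>1 * (m\<^sub>1 * C * 0) + m\<^sub>2 * C * ((a * m\<^sub>2 * C\<^sup>2 * 0 + m\<^sub>1 * C * 0 * 0) / (1 - \<rho>)) + m\<^sub>3 * C ^ 3 * 0"
    unfolding B_def using subcritical by (intro tendsto_intros inv \<tau>) auto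
  then have B: "B \<longlonglongrightarrow> 0" by simp
  let ?s = "complex_of_real (1 - \<rho>)"
  have nz: "?s \<noteq> 0" using subcritical by (simp only: of_real_eq_0_iff)
  define F where "F t = ?s * (\<Sum>n<t. D (w t) n) - t * (m\<^sub>1 * w t) - m\<^sub>2 / 2 * (t * (w t / ?s)\<^sup>2)" for t
  have "F \<longlonglongrightarrow> 0"
  proof (rule Lim_null_comparison[OF _ B])
    show "eventually (\<lambda>t. norm (F t) \<le> B t) sequentially"
      using eventually_gt_at_top[of 0]
    proof eventually_elim
      case (elim t)
      define r where "r = sqrt (real t)"
      have r: "r > 0" "real t = r\<^sup>2" using elim by (auto simp: r_def)
      have K: "norm (w t) / (1 - \<rho>) = C / r" using r
        by (simp add: w_def C_def norm_mult norm_divide r_def[symmetric])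
      have \<tau>: "(\<Sum>n<t. T n) = \<tau> t * r" using r by (simp add: \<tau>_def r_def[symmetric])
      have "Re (w t) \<le> 0" by (simp add: w_def)
      from cumulant_expansion[OF this, of t] show ?case
        unfolding F_def B_def K \<tau> r_def[symmetric] r(2) using r(1)
        by (simp add: power2_eq_square power3_eq_cube field_simps)
    qed
  qed
  then have "(\<lambda>t. F t / ?s + m\<^sub>2 / 2 * (of_real (- (\<theta>\<^sup>2)) / ?s\<^sup>2) / ?s) \<longlonglongrightarrow>
      0 / ?s + m\<^sub>2 / 2 * (of_real (- (\<theta>\<^sup>2)) / ?s\<^sup>2) / ?s"
    using nz by (intro tendsto_intros) auto
  also have "0 / ?s + m\<^sub>2 / 2 * (of_real (- (\<theta>\<^sup>2)) / ?s\<^sup>2) / ?s = of_real (- (m\<^sub>2 * \<theta>\<^sup>2 / (2 * (1 - \<rho>) ^ 3)))"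
    by (simp add: power2_eq_square power3_eq_cube)
  finally show ?thesis
  proof (rule Lim_transform_eventually)
    \<comment> \<open>Restricted to t > 0: at t = 0 division by zero makes \<open>w t\<close>
      vanish, and \<open>t * (w t)\<^sup>2\<close> is no longer -\<theta>^2.\<close>
    show "eventually (\<lambda>t. F t / ?s + m\<^sub>2 / 2 * (of_real (- (\<theta>\<^sup>2)) / ?s\<^sup>2) / ?s
        = (\<Sum>n<t. D (w t) n) - t * (m\<^sub>1 * w t) / (1 - \<rho>)) sequentially"
      using eventually_gt_at_top[of 0]
    proof eventually_elim
      case (elim t)
      define r where "r = sqrt (real t)"
      have r: "r > 0" "real t = r\<^sup>2" using elim by (auto simp: r_def)
      have "of_real (real t) * (w t)\<^sup>2 = of_real (real t * - ((\<theta> / r)\<^sup>2))"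
        by (simp add: w_def power_mult_distrib r_def[symmetric] del: of_real_divide)
      also have "real t * - ((\<theta> / r)\<^sup>2) = - (\<theta>\<^sup>2)" using r by (simp add: power_divide)
      finally have "t * (w t / ?s)\<^sup>2 = of_real (- (\<theta>\<^sup>2)) / ?s\<^sup>2"
        by (simp add: power_divide del: of_real_diff)
      then have "F t + m\<^sub>2 / 2 * (of_real (- (\<theta>\<^sup>2)) / ?s\<^sup>2) = ?s * (\<Sum>n<t. D (w t) n) - t * (m\<^sub>1 * w t)"
        by (simp add: F_def del: of_real_diff)
      then have "(F t + m\<^sub>2 / 2 * (of_real (- (\<theta>\<^sup>2)) / ?s\<^sup>2)) / ?s = (?s * (\<Sum>n<t. D (w t) n) - t * (m\<^sub>1 * w t)) / ?s"
        by (rule arg_cong)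
      then show ?case using nz by (simp add: add_divide_distrib diff_divide_distrib del: of_real_diff)
    qed
  qed
qed

end

section \<open>Laplace transforms on the left half-plane\<close>

text \<open>With this sign the imaginary axis carries the characteristic function, and a nonnegative
  law has a transform bounded by 1 on Re z \<le> 0. The half-plane is used because the recursion
  starts on the axis but in general leaves it at once.\<close>

definition laplace :: "real measure \<Rightarrow> complex \<Rightarrow> complex" where
  "laplace \<mu> z = (CLINT x|\<mu>. exp (z * of_real x))"

lemma norm_exp_nonpos_le_1:
  fixes z :: complex
  assumes "Re z \<le> 0" "0 \<le> x"
  shows "norm (exp (z * of_real x)) \<le> 1"
  using assms by (simp add: mult_nonpos_nonneg)

text \<open>The half-plane is convex and exp, its own derivative, is bounded by 1 there, so the
  complex Taylor bound holds with constant 1.\<close>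

lemma exp_Taylor_nonpos:
  fixes z :: complex
  assumes "Re z \<le> 0"
  shows "norm (exp z - (\<Sum>i\<le>n. z ^ i / fact i)) \<le> norm z ^ Suc n / fact n"
proof -
  have "norm (exp z - (\<Sum>i\<le>n. exp 0 * (z - 0) ^ i / fact i)) \<le> 1 * norm (z - 0) ^ Suc n / fact n"
    by (rule complex_Taylor[where S = "{z. Re z \<le> 0}" and f = "\<lambda>_. exp"])
       (use assms in \<open>auto intro!: DERIV_exp has_field_derivative_at_within convex_halfspace_Re_le\<close>)
  then show ?thesis by simp
qed

locale nonneg_distribution = real_distribution \<mu> for \<mu> +
  assumes AE_nonneg: "AE x in \<mu>. 0 \<le> x"
begin

lemma laplace_integrable:
  assumes "Re z \<le> 0"
  shows "integrable \<mu> (\<lambda>x. exp (z * complex_of_real x))"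
proof (rule integrable_const_bound[where B = 1])
  show "AE x in \<mu>. norm (exp (z * complex_of_real x)) \<le> 1"
    using AE_nonneg by eventually_elim (rule norm_exp_nonpos_le_1[OF assms])
qed simp

lemma norm_laplace_le_1:
  assumes "Re z \<le> 0"
  shows "norm (laplace \<mu> z) \<le> 1"
proof -
  have "norm (laplace \<mu> z) \<le> (LINT x|\<mu>. norm (exp (z * complex_of_real x)))"
    unfolding laplace_def by (rule integral_norm_bound)
  also have "\<dots> \<le> (LINT x|\<mu>. 1)"
  proof (rule integral_mono_AE)
    show "AE x in \<mu>. norm (exp (z * complex_of_real x)) \<le> 1"
      using AE_nonneg by eventually_elim (rule norm_exp_nonpos_le_1[OF assms])
    show "integrable \<mu> (\<lambda>x. norm (exp (z * complex_of_real x)))"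
      by (rule integrable_norm[OF laplace_integrable[OF assms]])
  qed simp
  also have "\<dots> = 1" using prob_space by simp
  finally show ?thesis .
qed

text \<open>The pointwise expansion at z x, integrated; x \<ge> 0 turns |z x|^(n+1) into x^(n+1)
  |z|^(n+1).\<close>

lemma laplace_Taylor:
  assumes z: "Re z \<le> 0" and int: "\<And>k. k \<le> Suc n \<Longrightarrow> integrable \<mu> (\<lambda>x. x ^ k)"
  shows "norm (laplace \<mu> z - (\<Sum>i\<le>n. of_real (LINT x|\<mu>. x ^ i) * z ^ i / fact i))
    \<le> (LINT x|\<mu>. x ^ Suc n) * norm z ^ Suc n / fact n"
proof -
  let ?p = "\<lambda>x::real. \<Sum>i\<le>n. of_real (x ^ i) * (z ^ i / fact i)"
  have int': "integrable \<mu> (\<lambda>x. of_real (x ^ i) * (z ^ i / fact i))" if "i \<le> n" for i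
    using int[of i] that by (intro integrable_mult_left integrable_of_real) auto
  have p: "integrable \<mu> ?p" "(LINT x|\<mu>. ?p x) = (\<Sum>i\<le>n. of_real (LINT x|\<mu>. x ^ i) * z ^ i / fact i)"
  proof -
    show "integrable \<mu> ?p" using int' by (intro Bochner_Integration.integrable_sum) auto
    have "(LINT x|\<mu>. ?p x) = (\<Sum>i\<le>n. (LINT x|\<mu>. of_real (x ^ i) * (z ^ i / fact i)))"
      using int' by (intro Bochner_Integration.integral_sum) auto
    also have "\<dots> = (\<Sum>i\<le>n. of_real (LINT x|\<mu>. x ^ i) * (z ^ i / fact i))"
      by (simp only: integral_mult_left_zero integral_complex_of_real)
    finally show "(LINT x|\<mu>. ?p x) = (\<Sum>i\<le>n. of_real (LINT x|\<mu>. x ^ i) * z ^ i / fact i)" by simp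
  qed
  have "norm (LINT x|\<mu>. exp (z * complex_of_real x) - ?p x) \<le> (LINT x|\<mu>. norm (exp (z * complex_of_real x) - ?p x))"
    by (rule integral_norm_bound)
  also have "\<dots> \<le> (LINT x|\<mu>. x ^ Suc n * (norm z ^ Suc n / fact n))"
  proof (rule integral_mono_AE)
    show "integrable \<mu> (\<lambda>x. norm (exp (z * complex_of_real x) - ?p x))"
      using laplace_integrable[OF z] p(1) by (intro integrable_norm Bochner_Integration.integrable_diff)
    show "integrable \<mu> (\<lambda>x. x ^ Suc n * (norm z ^ Suc n / fact n))"
      by (intro integrable_mult_left int) auto
    show "AE x in \<mu>. norm (exp (z * complex_of_real x) - ?p x) \<le> x ^ Suc n * (norm z ^ Suc n / fact n)"
      using AE_nonneg
    proof eventually_elim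
      case (elim x)
      then have "Re (z * complex_of_real x) \<le> 0" using z by (simp add: mult_nonpos_nonneg)
      from exp_Taylor_nonpos[OF this, of n] elim show ?case
        by (simp add: power_mult_distrib norm_mult mult_ac)
    qed
  qed
  also have "\<dots> = (LINT x|\<mu>. x ^ Suc n) * norm z ^ Suc n / fact n" by simp
  finally show ?thesis using laplace_integrable[OF z] p
    by (simp add: laplace_def)
qed

text \<open>Orders 0, 1 and 2 of \<open>laplace_Taylor\<close>, whose remainders involve the moments
  1, 2 and 3; at order 2 the spare factor 1 / 2 is dropped.\<close>

lemma cumulant_recursion_laplace:
  assumes "summable \<alpha>" "\<And>t. 0 \<le> \<alpha> t"
    and int: "\<And>k. k \<in> {1..3} \<Longrightarrow> integrable \<mu> (\<lambda>x. x ^ k)"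
    and "exciting_norm \<alpha> * (LINT x|\<mu>. x) < 1"
  shows "cumulant_recursion \<alpha> (laplace \<mu>) (LINT x|\<mu>. x) (LINT x|\<mu>. x\<^sup>2) (LINT x|\<mu>. x ^ 3)"
proof
  have int': "integrable \<mu> (\<lambda>x. x ^ k)" if "k \<le> 3" for k
    using int[of k] that by (cases "k = 0") auto
  have one: "prob UNIV = 1" using prob_space by simp
  have nn: "0 \<le> (LINT x|\<mu>. x ^ k)" for k
    by (rule integral_nonneg_AE) (use AE_nonneg in \<open>eventually_elim, simp\<close>)
  show "0 \<le> (LINT x|\<mu>. x)" "0 \<le> (LINT x|\<mu>. x\<^sup>2)" "0 \<le> (LINT x|\<mu>. x ^ 3)"
    using nn[of 1] nn[of 2] nn[of 3] by simp_all
  fix z :: complex assume z: "Re z \<le> 0"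
  show "Re (laplace \<mu> z) \<le> 1"
    using norm_laplace_le_1[OF z] complex_Re_le_cmod[of "laplace \<mu> z"] by linarith
  show "norm (laplace \<mu> z - 1) \<le> (LINT x|\<mu>. x) * norm z"
    using laplace_Taylor[OF z, of 0] int' by (simp add: one)
  show "norm (laplace \<mu> z - 1 - (LINT x|\<mu>. x) * z) \<le> (LINT x|\<mu>. x\<^sup>2) * norm z ^ 2"
    using laplace_Taylor[OF z, of 1] int' by (simp add: one diff_diff_eq numeral_2_eq_2)
  have "norm (laplace \<mu> z - 1 - (LINT x|\<mu>. x) * z - (LINT x|\<mu>. x\<^sup>2) / 2 * z\<^sup>2)
      \<le> (LINT x|\<mu>. x ^ 3) * norm z ^ 3 / 2"
    using laplace_Taylor[OF z, of 2] int'
    by (simp add: one diff_diff_eq numeral_2_eq_2 numeral_3_eq_3 add.assoc)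
  also have "\<dots> \<le> (LINT x|\<mu>. x ^ 3) * norm z ^ 3" using nn[of 3] by simp
  finally show "norm (laplace \<mu> z - 1 - (LINT x|\<mu>. x) * z - (LINT x|\<mu>. x\<^sup>2) / 2 * z\<^sup>2)
      \<le> (LINT x|\<mu>. x ^ 3) * norm z ^ 3" .
qed (fact assms)+

end

section \<open>The transform of the Hawkes process\<close>

text \<open>Passes from independent sigma-algebras, the form in which the model relates the marks to
  the past, to independent variables: f and g generate sigma-algebras inside A and B.\<close>

lemma (in prob_space) indep_var_of_indep_set:
  assumes indep: "indep_set (sets A) (sets B)"
    and space: "space A = space M" "space B = space M"
    and f: "f \<in> measurable A S" and g: "g \<in> measurable B T"
  shows "indep_var S f T g"
  unfolding indep_var_eq
proof (intro conjI)
  have sub: "sets A \<subseteq> events" "sets B \<subseteq> events"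
    using indep_setD_ev1[OF indep] indep_setD_ev2[OF indep] by auto
  show "random_variable S f" "random_variable T g"
    using f g sub space by (auto simp: measurable_def)
  have "sigma_sets (space M) {f -` C \<inter> space M |C. C \<in> sets S} \<subseteq> sets A"
    unfolding space(1)[symmetric] by (rule sets.sigma_sets_subset) (use f in auto)
  moreover have "sigma_sets (space M) {g -` C \<inter> space M |C. C \<in> sets T} \<subseteq> sets B"
    unfolding space(2)[symmetric] by (rule sets.sigma_sets_subset) (use g in auto)
  ultimately show "indep_set (sigma_sets (space M) {f -` C \<inter> space M |C. C \<in> sets S})
      (sigma_sets (space M) {g -` C \<inter> space M |C. C \<in> sets T})"
    using indep unfolding indep_set_def
    by (elim indep_sets_mono_sets) (auto split: bool.split)
qed

context marked_hawkes
begin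

section \<open>Measurability and positivity of the process\<close>

lemma l_measurable [measurable]: "1 \<le> t \<Longrightarrow> 1 \<le> j \<Longrightarrow> l t j \<in> borel_measurable M"
  using marks_indep by (auto simp: indep_vars_def)

lemma X_measurable [measurable]: "X t \<in> borel_measurable M"
proof (cases "t = 0")
  case True
  then show ?thesis using X_0 by (subst measurable_cong[where g = "\<lambda>_. 0"]) auto
next
  case False
  then have t: "1 \<le> t" by simp
  \<comment> \<open>Splitting over the countably many values of \<open>Z t\<close> makes the number
    of summands deterministic.\<close>
  have "(\<lambda>\<omega>. (\<Sum>j = 1..Z t \<omega>. l t j \<omega>)) \<in> borel_measurable M"
    by (rule measurable_compose_countable[OF _ counts_measurable[OF t]])
       (intro borel_measurable_sum l_measurable[OF t], simp)
  then show ?thesis using X_eq[OF t] by (subst measurable_cong) auto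
qed

lemma X_nonneg: "AE \<omega> in M. \<forall>t. 0 \<le> X t \<omega>"
proof -
  \<comment> \<open>There are countably many marks, so one null set serves every t and every random
    number of summands.\<close>
  have "AE \<omega> in M. \<forall>t\<in>{1..}. \<forall>j\<in>{1..}. 0 < l t j \<omega>"
    by (simp only: AE_ball_countable[OF countableI_type]) (use marks_pos in auto)
  with AE_space show ?thesis
  proof eventually_elim
    case (elim \<omega>)
    show ?case
    proof
      fix t show "0 \<le> X t \<omega>"
      proof (cases "t = 0")
        case False
        then have "0 \<le> (\<Sum>j = 1..Z t \<omega>. l t j \<omega>)"
          using elim by (intro sum_nonneg) (auto intro: less_imp_le)
        then show ?thesis using False elim by (simp add: X_eq)
      qed (use elim X_0 in simp)
    qed
  qed
qed

text \<open>Lets the conditional law be written with the explicit Poisson masses, which are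
  available at positive rates.\<close>

lemma intensity_pos: "AE \<omega> in M. 0 < intensity \<nu> \<alpha> X t \<omega>"
  using X_nonneg
proof eventually_elim
  case (elim \<omega>)
  have "0 \<le> (\<Sum>s = 1..<t. \<alpha> s * X (t - s) \<omega>)"
    using elim exciting_pos by (intro sum_nonneg mult_nonneg_nonneg) (auto intro: less_imp_le)
  then show ?case using base_pos by (simp add: intensity_def)
qed

section \<open>The mark law and sums of a fixed number of marks\<close>

definition mark_distribution :: "real measure" where
  "mark_distribution = distr M borel (l 1 1)"

abbreviation \<Phi> :: "complex \<Rightarrow> complex" where
  "\<Phi> \<equiv> laplace mark_distribution"

sublocale mark: nonneg_distribution mark_distribution
proof -
  have "AE x in distr M borel (l 1 1). 0 \<le> x"
    using marks_pos[of 1 1] by (subst AE_distr_iff) (auto intro: less_imp_le)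
  then show "nonneg_distribution mark_distribution"
    unfolding nonneg_distribution_def nonneg_distribution_axioms_def mark_distribution_def
    by (intro conjI real_distribution_distr l_measurable) simp_all
qed

lemma expectation_mark:
  assumes "1 \<le> t" "1 \<le> j" and [measurable]: "f \<in> borel_measurable borel"
  shows "(\<integral>\<omega>. f (l t j \<omega>) \<partial>M) = (\<integral>x. f x \<partial>mark_distribution :: complex)"
proof -
  have "(\<integral>\<omega>. f (l t j \<omega>) \<partial>M) = (\<integral>x. f x \<partial>distr M borel (l t j))"
    using l_measurable[OF assms(1,2)] by (simp add: integral_distr)
  then show ?thesis unfolding marks_identical[OF assms(1,2)] mark_distribution_def .
qed

text \<open>exp turns the sum of n independent marks into a product of n independent factors, each
  with mean \<open>\<Phi> z\<close>.\<close>

lemma compound_transform: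
  assumes t: "1 \<le> t" and z: "Re z \<le> 0"
  shows "(\<integral>\<omega>. exp (z * (\<Sum>j = 1..n. complex_of_real (l t j \<omega>))) \<partial>M) = \<Phi> z ^ n"
    and "integrable M (\<lambda>\<omega>. exp (z * (\<Sum>j = 1..n. complex_of_real (l t j \<omega>))))"
proof -
  let ?f = "\<lambda>x. exp (z * complex_of_real x)"
  \<comment> \<open>Independence is assumed over pairs (time, index); the marks of one time are the
    slice of pairs with first entry t.\<close>
  have "indep_vars (\<lambda>_. borel) (\<lambda>(t, j). l t j) (Pair t ` {1..n})"
    using marks_indep by (rule indep_vars_subset) (use t in auto)
  then have ind: "indep_vars (\<lambda>_. borel) (\<lambda>p \<omega>. ?f ((case p of (t, j) \<Rightarrow> l t j) \<omega>)) (Pair t ` {1..n})"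
    by (rule indep_vars_compose2) simp
  have int: "integrable M (\<lambda>\<omega>. ?f ((case p of (t, j) \<Rightarrow> l t j) \<omega>))" if "p \<in> Pair t ` {1..n}" for p
  proof -
    from that obtain j where p: "p = (t, j)" and "j \<in> {1..n}" by (rule imageE)
    then have j: "1 \<le> j" by simp
    show ?thesis
    proof (rule integrable_const_bound[where B = 1])
      show "AE \<omega> in M. norm (?f ((case p of (t, j) \<Rightarrow> l t j) \<omega>)) \<le> 1"
        using marks_pos[OF t j]
      proof eventually_elim
        case (elim \<omega>)
        then show ?case unfolding p by (intro norm_exp_nonpos_le_1 z) simp
      qed
      show "(\<lambda>\<omega>. ?f ((case p of (t, j) \<Rightarrow> l t j) \<omega>)) \<in> borel_measurable M"
        unfolding p using l_measurable[OF t j] by simp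
    qed
  qed
  have eq: "exp (z * (\<Sum>j = 1..n. complex_of_real (l t j \<omega>)))
      = (\<Prod>p\<in>Pair t ` {1..n}. ?f ((case p of (t, j) \<Rightarrow> l t j) \<omega>))" for \<omega>
    by (simp add: sum_distrib_left exp_sum prod.reindex inj_on_def)
  show "(\<integral>\<omega>. exp (z * (\<Sum>j = 1..n. complex_of_real (l t j \<omega>))) \<partial>M) = \<Phi> z ^ n"
    unfolding eq
    by (subst indep_vars_lebesgue_integral[OF _ ind int])
       (use t expectation_mark[where f = ?f] in \<open>simp_all add: laplace_def prod.reindex inj_on_def\<close>)
  show "integrable M (\<lambda>\<omega>. exp (z * (\<Sum>j = 1..n. complex_of_real (l t j \<omega>))))"
    unfolding eq by (rule indep_vars_integrable[OF _ ind int]) simp_all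
qed

section \<open>Histories and predictability of the intensity\<close>

lemma history_generators:
  "(\<Union>s\<in>{1..t}. sets (vimage_algebra (space M) (Z s) (count_space UNIV)) \<union>
      sets (vimage_algebra (space M) (X s) borel)) \<subseteq> events"
  using counts_measurable X_measurable unfolding measurable_iff_sets
  by (intro UN_least Un_least) simp_all

lemma space_history [simp]: "space (history M Z X t) = space M"
  by (simp add: history_def space_measure_of_conv)

lemma sets_history:
  "sets (history M Z X t) = sigma_sets (space M)
     (\<Union>s\<in>{1..t}. sets (vimage_algebra (space M) (Z s) (count_space UNIV)) \<union>
        sets (vimage_algebra (space M) (X s) borel))"
  unfolding history_def by (rule sets_measure_of[OF order_trans[OF history_generators sets.space_closed]])

sublocale history: finite_measure_subalgebra M "history M Z X t" for t
proof
  show "subalgebra M (history M Z X t)"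
    unfolding subalgebra_def sets_history
    by (intro conjI space_history sets.sigma_sets_subset history_generators)
qed

lemma X_history_measurable:
  assumes "1 \<le> s" "s \<le> t"
  shows "X s \<in> borel_measurable (history M Z X t)"
  using assms unfolding measurable_iff_sets sets_history by (auto intro!: sigma_sets.Basic)

text \<open>Predictability: for lags 1 \<le> s < t the times t - s range over 1, ..., t - 1
  only.\<close>

lemma intensity_history_measurable:
  "intensity \<nu> \<alpha> X t \<in> borel_measurable (history M Z X (t - 1))"
  unfolding intensity_def
  by (intro borel_measurable_add borel_measurable_sum borel_measurable_times borel_measurable_const)
     (auto intro!: X_history_measurable)

lemma intensity_measurable [measurable]: "intensity \<nu> \<alpha> X t \<in> borel_measurable M"
  using measurable_from_subalg[OF history.subalg intensity_history_measurable] .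

section \<open>Conditional transform of one step\<close>

text \<open>The Poisson masses at the current rate, spelled out so that they can be summed as a
  power series against \<open>\<Phi> z ^ n\<close>.\<close>

abbreviation count_prob :: "nat \<Rightarrow> nat \<Rightarrow> 'a \<Rightarrow> real" where
  "count_prob t n \<omega> \<equiv> intensity \<nu> \<alpha> X t \<omega> ^ n / fact n * exp (- intensity \<nu> \<alpha> X t \<omega>)"

text \<open>The conditional expectation is real-valued while Y is complex, so its defining property
  is applied to the real and imaginary parts of Y separately.\<close>

lemma cond_count:
  fixes Y :: "'a \<Rightarrow> complex"
  assumes t: "1 \<le> t" and Y: "Y \<in> borel_measurable (history M Z X (t - 1))"
    and bound: "AE \<omega> in M. norm (Y \<omega>) \<le> 1"
  shows "(\<integral>\<omega>. Y \<omega> * indicator {\<omega> \<in> space M. Z t \<omega> = n} \<omega> \<partial>M) = (\<integral>\<omega>. Y \<omega> * of_real (count_prob t n \<omega>) \<partial>M)"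
    and "integrable M (\<lambda>\<omega>. Y \<omega> * indicator {\<omega> \<in> space M. Z t \<omega> = n} \<omega>)"
    and "integrable M (\<lambda>\<omega>. Y \<omega> * of_real (count_prob t n \<omega>))"
proof -
  let ?F = "history M Z X (t - 1)" and ?A = "{\<omega> \<in> space M. Z t \<omega> = n}"
  note [measurable] = counts_measurable[OF t] measurable_from_subalg[OF history.subalg Y]
  have A [measurable]: "?A \<in> events" by measurable
  have real: "integrable M (\<lambda>\<omega>. y \<omega> * count_prob t n \<omega>) \<and>
      (\<integral>\<omega>. y \<omega> * indicator ?A \<omega> \<partial>M) = (\<integral>\<omega>. y \<omega> * count_prob t n \<omega> \<partial>M)"
    if y: "y \<in> borel_measurable ?F" and "AE \<omega> in M. \<bar>y \<omega>\<bar> \<le> 1" for y :: "'a \<Rightarrow> real"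
  proof -
    note [measurable] = measurable_from_subalg[OF history.subalg y]
    have "integrable M (\<lambda>\<omega>. y \<omega> * indicator ?A \<omega>)"
    proof (rule integrable_const_bound[where B = 1])
      show "AE \<omega> in M. norm (y \<omega> * indicator ?A \<omega>) \<le> 1"
        using that(2) by eventually_elim (simp add: indicator_def)
    qed measurable
    note ce = history.real_cond_exp_intg[OF this y]
    have ae: "AE \<omega> in M. y \<omega> * real_cond_exp M ?F (indicator ?A) \<omega> = y \<omega> * count_prob t n \<omega>"
      using counts_poisson[OF t, of n] intensity_pos[of t] by eventually_elim simp
    have "integrable M (\<lambda>\<omega>. y \<omega> * count_prob t n \<omega>)"
      using ce(1) by (rule integrable_cong_AE_imp) (use ae in \<open>auto elim: eventually_mono\<close>)
    moreover have "(\<integral>\<omega>. y \<omega> * real_cond_exp M ?F (indicator ?A) \<omega> \<partial>M) = (\<integral>\<omega>. y \<omega> * count_prob t n \<omega> \<partial>M)"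
      by (rule integral_cong_AE) (use ae in auto)
    ultimately show ?thesis using ce(2) by simp
  qed
  have re: "(\<lambda>\<omega>. Re (Y \<omega>)) \<in> borel_measurable ?F" "AE \<omega> in M. \<bar>Re (Y \<omega>)\<bar> \<le> 1"
    using Y bound by (auto elim!: eventually_mono intro: order_trans[OF abs_Re_le_cmod])
  have im: "(\<lambda>\<omega>. Im (Y \<omega>)) \<in> borel_measurable ?F" "AE \<omega> in M. \<bar>Im (Y \<omega>)\<bar> \<le> 1"
    using Y bound by (auto elim!: eventually_mono intro: order_trans[OF abs_Im_le_cmod])
  show 1: "integrable M (\<lambda>\<omega>. Y \<omega> * indicator ?A \<omega>)"
  proof (rule integrable_const_bound[where B = 1])
    show "AE \<omega> in M. norm (Y \<omega> * indicator ?A \<omega>) \<le> 1"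
      using bound by eventually_elim (simp add: indicator_def)
  qed measurable
  show 2: "integrable M (\<lambda>\<omega>. Y \<omega> * of_real (count_prob t n \<omega>))"
  proof -
    have "integrable M (\<lambda>\<omega>. of_real (Re (Y \<omega>) * count_prob t n \<omega>) + \<i> * of_real (Im (Y \<omega>) * count_prob t n \<omega>))"
      using real[OF re] real[OF im]
      by (intro Bochner_Integration.integrable_add integrable_mult_right integrable_of_real) blast+
    moreover have "of_real (Re w * x) + \<i> * of_real (Im w * x) = w * complex_of_real x" for w x
      by (simp add: complex_eq_iff)
    ultimately show ?thesis by (simp only:)
  qed
  have ind: "Re (w * indicator ?A \<omega>) = Re w * indicator ?A \<omega>" "Im (w * indicator ?A \<omega>) = Im w * indicator ?A \<omega>" for w \<omega>
    by (simp_all add: indicator_def)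
  have scale: "Re (w * of_real x) = Re w * x" "Im (w * of_real x) = Im w * x" for w x
    by simp_all
  show "(\<integral>\<omega>. Y \<omega> * indicator ?A \<omega> \<partial>M) = (\<integral>\<omega>. Y \<omega> * of_real (count_prob t n \<omega>) \<partial>M)"
    unfolding complex_eq_iff integral_Re[OF 1, symmetric] integral_Re[OF 2, symmetric]
      integral_Im[OF 1, symmetric] integral_Im[OF 2, symmetric] ind scale
    using real[OF re] real[OF im] by blast
qed

text \<open>On the event that \<open>Z t\<close> is n, \<open>X t\<close> is a sum of n marks that
  are independent of the past and of the count. Their transform factors out as
  \<open>\<Phi> z ^ n\<close>, and \<open>cond_count\<close> evaluates the rest.\<close>

lemma count_marks_transform:
  fixes Y :: "'a \<Rightarrow> complex"
  assumes t: "1 \<le> t" and Y: "Y \<in> borel_measurable (history M Z X (t - 1))"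
    and bound: "AE \<omega> in M. norm (Y \<omega>) \<le> 1" and z: "Re z \<le> 0"
  shows "(\<integral>\<omega>. Y \<omega> * indicator {\<omega> \<in> space M. Z t \<omega> = n} \<omega> * exp (z * (\<Sum>j = 1..n. complex_of_real (l t j \<omega>))) \<partial>M)
      = (\<integral>\<omega>. Y \<omega> * of_real (count_prob t n \<omega>) * \<Phi> z ^ n \<partial>M)"
    and "integrable M (\<lambda>\<omega>. Y \<omega> * indicator {\<omega> \<in> space M. Z t \<omega> = n} \<omega> * exp (z * (\<Sum>j = 1..n. complex_of_real (l t j \<omega>))))"
proof -
  let ?A = "{\<omega> \<in> space M. Z t \<omega> = n}"
  let ?W = "\<lambda>\<omega>. Y \<omega> * indicator ?A \<omega>" and ?V = "\<lambda>\<omega>. exp (z * (\<Sum>j = 1..n. complex_of_real (l t j \<omega>)))"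
  \<comment> \<open>P and H are the two sigma-algebras of \<open>marks_indep_past\<close>, packaged
    as measures so that measurability can be stated relative to them.\<close>
  define P where "P = sigma (space M) (sets (history M Z X (t - 1)) \<union> sets (vimage_algebra (space M) (Z t) (count_space UNIV)))"
  define H where "H = sigma (space M) (\<Union>j\<in>{1..}. sets (vimage_algebra (space M) (l t j) borel))"
  have subP: "sets (history M Z X (t - 1)) \<union> sets (vimage_algebra (space M) (Z t) (count_space UNIV)) \<subseteq> Pow (space M)"
    using sets.space_closed[of "history M Z X (t - 1)"] sets.space_closed[of "vimage_algebra (space M) (Z t) (count_space UNIV)"]
    by simp
  have subH: "(\<Union>j\<in>{1..}. sets (vimage_algebra (space M) (l t j) borel)) \<subseteq> Pow (space M)"
    using sets.space_closed[of "vimage_algebra (space M) (l t j) borel" for j] by auto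
  have sp: "space P = space M" "space H = space M" by (simp_all add: P_def H_def space_measure_of_conv)
  have setsP: "sets P = sigma_sets (space M) (sets (history M Z X (t - 1)) \<union> sets (vimage_algebra (space M) (Z t) (count_space UNIV)))"
    unfolding P_def by (rule sets_measure_of[OF subP])
  have setsH: "sets H = sigma_sets (space M) (\<Union>j\<in>{1..}. sets (vimage_algebra (space M) (l t j) borel))"
    unfolding H_def by (rule sets_measure_of[OF subH])
  have [measurable]: "Y \<in> borel_measurable P"
    by (rule measurable_from_subalg[OF _ Y]) (auto simp: subalgebra_def sp setsP)
  have [measurable]: "Z t \<in> measurable P (count_space UNIV)"
    unfolding measurable_iff_sets sp setsP by auto
  have "?W \<in> borel_measurable P"
    unfolding sp(1)[symmetric] by measurable
  moreover have "?V \<in> borel_measurable H"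
  proof -
    have [measurable]: "l t j \<in> borel_measurable H" if "j \<in> {1..n}" for j
      using that unfolding measurable_iff_sets sp setsH by (auto intro!: sigma_sets.Basic)
    show ?thesis by measurable
  qed
  moreover have "indep_set (sets P) (sets H)"
    unfolding setsP setsH using marks_indep_past[OF t] .
  ultimately have "indep_var borel ?W borel ?V"
    using sp by (intro indep_var_of_indep_set)
  note indep = this cond_count(2)[OF t Y bound] compound_transform(2)[OF t z]
  show "integrable M (\<lambda>\<omega>. ?W \<omega> * ?V \<omega>)"
    using indep by (rule indep_var_integrable)
  have "(\<integral>\<omega>. ?W \<omega> * ?V \<omega> \<partial>M) = (\<integral>\<omega>. ?W \<omega> \<partial>M) * \<Phi> z ^ n"
    unfolding compound_transform(1)[OF t z, symmetric] using indep by (rule indep_var_lebesgue_integral)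
  then show "(\<integral>\<omega>. ?W \<omega> * ?V \<omega> \<partial>M) = (\<integral>\<omega>. Y \<omega> * of_real (count_prob t n \<omega>) * \<Phi> z ^ n \<partial>M)"
    unfolding cond_count(1)[OF t Y bound] integral_mult_left_zero .
qed

text \<open>The conditional compound Poisson transform, tested against past variables Y. Both sides
  are split over the value n of the count, compared termwise, and resummed by dominated
  convergence.\<close>

lemma X_transform:
  fixes Y :: "'a \<Rightarrow> complex"
  assumes t: "1 \<le> t" and Y: "Y \<in> borel_measurable (history M Z X (t - 1))"
    and bound: "AE \<omega> in M. norm (Y \<omega>) \<le> 1" and z: "Re z \<le> 0"
  shows "(\<integral>\<omega>. Y \<omega> * exp (z * of_real (X t \<omega>)) \<partial>M)
    = (\<integral>\<omega>. Y \<omega> * exp (of_real (intensity \<nu> \<alpha> X t \<omega>) * (\<Phi> z - 1)) \<partial>M)"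
proof -
  let ?A = "\<lambda>n. {\<omega> \<in> space M. Z t \<omega> = n}"
  let ?f = "\<lambda>n \<omega>. Y \<omega> * indicator (?A n) \<omega> * exp (z * (\<Sum>j = 1..n. complex_of_real (l t j \<omega>)))"
  let ?g = "\<lambda>n \<omega>. Y \<omega> * of_real (count_prob t n \<omega>) * \<Phi> z ^ n"
  note [measurable] = counts_measurable[OF t] measurable_from_subalg[OF history.subalg Y]
  have f_int: "integrable M (?f n)" for n by (rule count_marks_transform(2)[OF assms])
  have g_int: "integrable M (?g n)" for n by (rule integrable_mult_left[OF cond_count(3)[OF t Y bound]])
  \<comment> \<open>Summing to N truncates to the event that \<open>Z t\<close> is below N, so the
    partial sums inherit the bound 1.\<close>
  have f_sum: "(\<Sum>n<N. ?f n \<omega>) = (if Z t \<omega> < N then Y \<omega> * exp (z * of_real (X t \<omega>)) else 0)"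
    if "\<omega> \<in> space M" for N \<omega>
  proof -
    have "(\<Sum>n<N. ?f n \<omega>) = (\<Sum>n<N. if n = Z t \<omega> then Y \<omega> * exp (z * of_real (X t \<omega>)) else 0)"
      using that by (intro sum.cong) (auto simp: indicator_def X_eq[OF t])
    then show ?thesis by simp
  qed
  \<comment> \<open>The Poisson generating function: the exponential series at x
    \<open>\<Phi> z\<close>, multiplied by exp (-x), where x is the intensity.\<close>
  have g_sums: "(\<lambda>n. ?g n \<omega>) sums (Y \<omega> * exp (of_real (intensity \<nu> \<alpha> X t \<omega>) * (\<Phi> z - 1)))" for \<omega>
  proof -
    let ?x = "complex_of_real (intensity \<nu> \<alpha> X t \<omega>)"
    have "(\<lambda>n. Y \<omega> * exp (- ?x) * ((?x * \<Phi> z) ^ n /\<^sub>R fact n)) sums (Y \<omega> * exp (- ?x) * exp (?x * \<Phi> z))"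
      by (intro sums_mult exp_converges)
    moreover have "Y \<omega> * exp (- ?x) * exp (?x * \<Phi> z) = Y \<omega> * exp (?x * (\<Phi> z - 1))"
      by (simp add: mult.assoc exp_add[symmetric] algebra_simps)
    moreover have "Y \<omega> * exp (- ?x) * ((?x * \<Phi> z) ^ n /\<^sub>R fact n) = ?g n \<omega>" for n
      by (simp add: scaleR_conv_of_real exp_of_real[symmetric] power_mult_distrib divide_inverse mult_ac)
    ultimately show ?thesis by (simp only:)
  qed
  have "(\<lambda>N. \<integral>\<omega>. (\<Sum>n<N. ?f n \<omega>) \<partial>M) \<longlonglongrightarrow> (\<integral>\<omega>. Y \<omega> * exp (z * of_real (X t \<omega>)) \<partial>M)"
  proof (rule integral_dominated_convergence[where w = "\<lambda>_. 1"])
    show "AE \<omega> in M. (\<lambda>N. \<Sum>n<N. ?f n \<omega>) \<longlonglongrightarrow> Y \<omega> * exp (z * of_real (X t \<omega>))"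
    proof (rule AE_I2)
      fix \<omega> assume \<omega>: "\<omega> \<in> space M"
      have "eventually (\<lambda>N. (\<Sum>n<N. ?f n \<omega>) = Y \<omega> * exp (z * of_real (X t \<omega>))) sequentially"
        using eventually_gt_at_top[of "Z t \<omega>"] by eventually_elim (simp only: f_sum[OF \<omega>] if_True)
      then show "(\<lambda>N. \<Sum>n<N. ?f n \<omega>) \<longlonglongrightarrow> Y \<omega> * exp (z * of_real (X t \<omega>))" by (rule tendsto_eventually)
    qed
    fix N
    show "AE \<omega> in M. norm (\<Sum>n<N. ?f n \<omega>) \<le> 1"
      using bound X_nonneg AE_space
    proof eventually_elim
      case (elim \<omega>)
      have "norm (Y \<omega> * exp (z * of_real (X t \<omega>))) \<le> 1 * 1"
        unfolding norm_mult using elim norm_exp_nonpos_le_1[OF z, of "X t \<omega>"] by (intro mult_mono) auto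
      then show ?case unfolding f_sum[OF elim(3)] by simp
    qed
    show "(\<lambda>\<omega>. \<Sum>n<N. ?f n \<omega>) \<in> borel_measurable M"
      using f_int by (intro borel_measurable_sum) auto
  qed simp_all
  moreover have "(\<lambda>N. \<integral>\<omega>. (\<Sum>n<N. ?g n \<omega>) \<partial>M)
      \<longlonglongrightarrow> (\<integral>\<omega>. Y \<omega> * exp (of_real (intensity \<nu> \<alpha> X t \<omega>) * (\<Phi> z - 1)) \<partial>M)"
  proof (rule integral_dominated_convergence[where w = "\<lambda>_. 1"])
    show "AE \<omega> in M. (\<lambda>N. \<Sum>n<N. ?g n \<omega>) \<longlonglongrightarrow> Y \<omega> * exp (of_real (intensity \<nu> \<alpha> X t \<omega>) * (\<Phi> z - 1))"
      using g_sums by (auto simp: sums_def)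
    fix N
    show "AE \<omega> in M. norm (\<Sum>n<N. ?g n \<omega>) \<le> 1"
      using bound intensity_pos[of t]
    proof eventually_elim
      case (elim \<omega>)
      let ?x = "intensity \<nu> \<alpha> X t \<omega>"
      \<comment> \<open>Since |Y| and \<open>norm (\<Phi> z)\<close> are at most 1, the terms are
        dominated by Poisson masses, whose total is 1.\<close>
      have sums: "(\<lambda>n. count_prob t n \<omega>) sums (exp ?x * exp (- ?x))"
        using sums_mult2[OF exp_converges[of ?x], of "exp (- ?x)"] by (simp add: divide_inverse mult_ac)
      have nn: "0 \<le> count_prob t n \<omega>" for n using elim by simp
      have "norm (\<Sum>n<N. ?g n \<omega>) \<le> (\<Sum>n<N. count_prob t n \<omega>)"
      proof (rule order_trans[OF norm_sum], rule sum_mono)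
        fix n
        have "norm (?g n \<omega>) = norm (Y \<omega>) * count_prob t n \<omega> * norm (\<Phi> z) ^ n"
          by (simp only: norm_mult norm_power norm_of_real abs_of_nonneg[OF nn])
        also have "\<dots> \<le> 1 * count_prob t n \<omega> * 1"
          using elim(1) nn[of n] mark.norm_laplace_le_1[OF z]
          by (intro mult_mono mult_right_mono power_le_one) auto
        finally show "norm (?g n \<omega>) \<le> count_prob t n \<omega>" by simp
      qed
      also have "\<dots> \<le> (\<Sum>n. count_prob t n \<omega>)"
        by (rule sum_le_suminf) (use sums nn in \<open>auto simp: sums_iff\<close>)
      also have "\<dots> = 1" using sums by (simp add: sums_iff exp_minus)
      finally show ?case .
    qed
    show "(\<lambda>\<omega>. \<Sum>n<N. ?g n \<omega>) \<in> borel_measurable M"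
      using g_int by (intro borel_measurable_sum) auto
  qed simp_all
  moreover have "(\<integral>\<omega>. (\<Sum>n<N. ?f n \<omega>) \<partial>M) = (\<integral>\<omega>. (\<Sum>n<N. ?g n \<omega>) \<partial>M)" for N
    unfolding Bochner_Integration.integral_sum[OF f_int] Bochner_Integration.integral_sum[OF g_int]
    by (intro sum.cong refl count_marks_transform(1)[OF assms])
  ultimately show ?thesis by (simp only: LIMSEQ_unique)
qed

section \<open>Backward integration over all steps\<close>

text \<open>The conditional rate is affine in the earlier X, so removing the last step keeps the
  exponent linear: \<nu> yields a constant factor, and each earlier \<open>X s\<close> gains a
  coefficient with lag t + 1 - s.\<close>

lemma joint_transform_step:
  assumes f: "\<And>s. s \<in> {1..Suc t} \<Longrightarrow> Re (f s) \<le> 0"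
  shows "(\<integral>\<omega>. exp (\<Sum>s = 1..Suc t. f s * of_real (X s \<omega>)) \<partial>M)
    = exp (of_real \<nu> * (\<Phi> (f (Suc t)) - 1))
      * (\<integral>\<omega>. exp (\<Sum>s = 1..t. (f s + of_real (\<alpha> (Suc t - s)) * (\<Phi> (f (Suc t)) - 1)) * of_real (X s \<omega>)) \<partial>M)"
proof -
  let ?Y = "\<lambda>\<omega>. exp (\<Sum>s = 1..t. f s * complex_of_real (X s \<omega>))"
  let ?d = "\<Phi> (f (Suc t)) - 1"
  have Y: "?Y \<in> borel_measurable (history M Z X (Suc t - 1))"
  proof -
    have [measurable]: "X s \<in> borel_measurable (history M Z X t)" if "s \<in> {1..t}" for s
      using that by (intro X_history_measurable) auto
    show ?thesis by simp
  qed
  have bound: "AE \<omega> in M. norm (?Y \<omega>) \<le> 1"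
    using X_nonneg
  proof eventually_elim
    case (elim \<omega>)
    have "(\<Sum>s = 1..t. Re (f s) * X s \<omega>) \<le> 0"
      using f elim by (intro sum_nonpos mult_nonpos_nonneg) auto
    then show ?case by simp
  qed
  have lam: "complex_of_real (intensity \<nu> \<alpha> X (Suc t) \<omega>) = of_real \<nu> + (\<Sum>s = 1..t. of_real (\<alpha> (Suc t - s)) * of_real (X s \<omega>))" for \<omega>
  proof -
    have "(\<Sum>s = 1..<Suc t. \<alpha> s * X (Suc t - s) \<omega>) = (\<Sum>s = 1..t. \<alpha> (Suc t - s) * X s \<omega>)"
      by (rule sum.reindex_bij_witness[where i = "\<lambda>s. Suc t - s" and j = "\<lambda>s. Suc t - s"]) auto
    then show ?thesis unfolding intensity_def by simp
  qed
  have eq: "(\<Sum>s = 1..t. f s * of_real (X s \<omega>)) + of_real (intensity \<nu> \<alpha> X (Suc t) \<omega>) * ?d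
      = of_real \<nu> * ?d + (\<Sum>s = 1..t. (f s + of_real (\<alpha> (Suc t - s)) * ?d) * of_real (X s \<omega>))" for \<omega>
  proof -
    have "(\<Sum>s = 1..t. (f s + of_real (\<alpha> (Suc t - s)) * ?d) * of_real (X s \<omega>))
        = (\<Sum>s = 1..t. f s * of_real (X s \<omega>)) + (\<Sum>s = 1..t. of_real (\<alpha> (Suc t - s)) * of_real (X s \<omega>)) * ?d"
      unfolding sum_distrib_right sum.distrib[symmetric] by (intro sum.cong) (simp_all add: algebra_simps)
    then show ?thesis unfolding lam by (simp only: distrib_right add_ac)
  qed
  have "(\<integral>\<omega>. exp (\<Sum>s = 1..Suc t. f s * of_real (X s \<omega>)) \<partial>M)
      = (\<integral>\<omega>. ?Y \<omega> * exp (f (Suc t) * of_real (X (Suc t) \<omega>)) \<partial>M)"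
    by (simp add: exp_add)
  also have "\<dots> = (\<integral>\<omega>. ?Y \<omega> * exp (of_real (intensity \<nu> \<alpha> X (Suc t) \<omega>) * ?d) \<partial>M)"
    using f by (intro X_transform[OF _ Y bound]) auto
  also have "\<dots> = (\<integral>\<omega>. exp (of_real \<nu> * ?d)
      * exp (\<Sum>s = 1..t. (f s + of_real (\<alpha> (Suc t - s)) * ?d) * of_real (X s \<omega>)) \<partial>M)"
    unfolding exp_add[symmetric] eq ..
  finally show ?thesis by simp
qed

text \<open>All coefficients start at w. When r steps have been removed, the coefficient of
  \<open>X (t - r)\<close> is exactly \<open>cumulant_seq\<close> at r, so integrating that step out
  contributes the term n = r of the exponent.\<close>

lemma cumulative_transform:
  assumes w: "Re w \<le> 0"
  shows "(\<integral>\<omega>. exp (w * of_real (cumulative_marks X t \<omega>)) \<partial>M)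
    = exp (of_real \<nu> * (\<Sum>n<t. \<Phi> (cumulant_seq \<alpha> \<Phi> w n) - 1))"
proof -
  define d where "d n = \<Phi> (cumulant_seq \<alpha> \<Phi> w n) - 1" for n
  \<comment> \<open>\<^term>\<open>f r s\<close> is the coefficient of \<^term>\<open>X s\<close> after the last \<^term>\<open>r\<close> steps have been integrated out.\<close>
  define f where "f r s = w + (\<Sum>j<r. of_real (\<alpha> (t - j - s)) * d j)" for r s
  have d: "Re (d n) \<le> 0" if "Re (cumulant_seq \<alpha> \<Phi> w n) \<le> 0" for n
    using mark.norm_laplace_le_1[OF that] complex_Re_le_cmod[of "\<Phi> (cumulant_seq \<alpha> \<Phi> w n)"]
    by (simp add: d_def)
  \<comment> \<open>Derived here from the bound 1 on \<Phi>: the process locale provides no second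
    or third moments with which to instantiate \<open>cumulant_recursion\<close>.\<close>
  have G: "Re (cumulant_seq \<alpha> \<Phi> w n) \<le> 0" for n
  proof (induction n rule: less_induct)
    case (less n)
    have "(\<Sum>j<n. \<alpha> (n - j) * Re (d j)) \<le> 0"
      using less d exciting_pos by (intro sum_nonpos mult_nonneg_nonpos) (auto intro: less_imp_le)
    then show ?case using w by (simp add: cumulant_seq.simps[of _ _ _ n] d_def)
  qed
  \<comment> \<open>Holds for every s: where natural subtraction truncates the lag to 0, \<alpha> is
    still nonnegative.\<close>
  have Re_f: "Re (f r s) \<le> 0" for r s
  proof -
    have "(\<Sum>j<r. \<alpha> (t - j - s) * Re (d j)) \<le> 0"
      using d[OF G] exciting_pos by (intro sum_nonpos mult_nonneg_nonpos) (auto intro: less_imp_le)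
    then show ?thesis using w by (simp add: f_def)
  qed
  have "(\<integral>\<omega>. exp (w * of_real (cumulative_marks X t \<omega>)) \<partial>M)
      = exp (of_real \<nu> * (\<Sum>n<r. d n)) * (\<integral>\<omega>. exp (\<Sum>s = 1..t - r. f r s * of_real (X s \<omega>)) \<partial>M)"
    if "r \<le> t" for r
    using that
  proof (induction r)
    case 0
    then show ?case by (simp add: f_def cumulative_marks_def sum_distrib_left)
  next
    case (Suc r)
    then have tr: "t - r = Suc (t - Suc r)" by simp
    \<comment> \<open>At s = t - r the lag t - j - s equals r - j, which is the lag of the
      recursion.\<close>
    have "f r (t - r) = cumulant_seq \<alpha> \<Phi> w r"
      using Suc.prems by (simp add: f_def d_def cumulant_seq.simps[of _ _ _ r])
    then have fd: "\<Phi> (f r (Suc (t - Suc r))) - 1 = d r"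
      using tr by (simp add: d_def)
    have f_Suc: "f r s + of_real (\<alpha> (Suc (t - Suc r) - s)) * d r = f (Suc r) s" for s
      by (simp add: f_def tr[symmetric] add.assoc)
    have "(\<integral>\<omega>. exp (\<Sum>s = 1..t - r. f r s * of_real (X s \<omega>)) \<partial>M)
        = exp (of_real \<nu> * d r) * (\<integral>\<omega>. exp (\<Sum>s = 1..t - Suc r. f (Suc r) s * of_real (X s \<omega>)) \<partial>M)"
      unfolding tr using joint_transform_step[of "t - Suc r" "f r"] Re_f unfolding fd f_Suc by blast
    then show ?case using Suc by (simp add: exp_add distrib_left)
  qed
  \<comment> \<open>At r = t no X is left, and the remaining expectation is that of the constant
    1.\<close>
  from this[of t] show ?thesis by (simp add: d_def prob_space)
qed

lemma cumulative_marks_measurable [measurable]: "cumulative_marks X t \<in> borel_measurable M"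
  unfolding cumulative_marks_def by measurable

end

section \<open>The central limit theorem\<close>

text \<open>N(0, \<sigma>^2) is the law of \<sigma> times a standard normal variable, so its
  characteristic function is the standard one at \<open>\<theta> * \<sigma>\<close>.\<close>

lemma char_normal_distribution:
  assumes "0 < \<sigma>"
  shows "char (density lborel (normal_density 0 \<sigma>)) \<theta> = of_real (exp (- (\<sigma>\<^sup>2 * \<theta>\<^sup>2 / 2)))"
proof -
  interpret N: real_distribution std_normal_distribution by (rule real_dist_normal_dist)
  have "distributed std_normal_distribution lborel (\<lambda>x. x) std_normal_density"
    by (simp add: distributed_def)
       (simp add: distr_id2)
  from N.normal_density_affine[OF this zero_less_one, of \<sigma> 0] assms
  have "distr std_normal_distribution lborel (\<lambda>x. \<sigma> * x) = density lborel (normal_density 0 \<sigma>)"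
    by (simp add: distributed_def)
  moreover have "distr std_normal_distribution lborel (\<lambda>x. \<sigma> * x) = distr std_normal_distribution borel (\<lambda>x. \<sigma> * x)"
    by (rule distr_cong) simp_all
  ultimately have "char (density lborel (normal_density 0 \<sigma>)) \<theta> = char (distr std_normal_distribution borel (\<lambda>x. \<sigma> * x)) \<theta>"
    by simp
  also have "\<dots> = char std_normal_distribution (\<theta> * \<sigma>)"
    unfolding char_def by (subst integral_distr) (simp_all add: mult.assoc)
  finally show ?thesis by (simp add: char_std_normal_distribution power_mult_distrib mult.commute)
qed

theorem theorem2p4:
  fixes M :: "'a measure"
    and \<nu> :: real
    and \<alpha> :: "nat \<Rightarrow> real"
    and l :: "nat \<Rightarrow> nat \<Rightarrow> 'a \<Rightarrow> real"
    and Z :: "nat \<Rightarrow> 'a \<Rightarrow> nat"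
    and X :: "nat \<Rightarrow> 'a \<Rightarrow> real"
  assumes hawkes: "marked_hawkes M \<nu> \<alpha> l Z X"
    and norm_finite: "summable \<alpha>"
    and stability: "exciting_norm \<alpha> * prob_space.expectation M (l 1 1) < 1"
    and moments: "\<And>t j k. 1 \<le> t \<Longrightarrow> 1 \<le> j \<Longrightarrow> k \<in> {1..4} \<Longrightarrow> integrable M (\<lambda>\<omega>. l t j \<omega> ^ k)"
    and tail: "(\<lambda>t. 1 / sqrt (real t) * (\<Sum>u = 1..<t. \<Sum>s. \<alpha> (s + (1 + u)))) \<longlonglongrightarrow> 0"
  shows "weak_conv_m
    (\<lambda>t. distr M borel (\<lambda>\<omega>. 1 / sqrt (real t) *
       (cumulative_marks X t \<omega>
        - \<nu> * prob_space.expectation M (l 1 1) * real t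
          / (1 - exciting_norm \<alpha> * prob_space.expectation M (l 1 1)))))
    (density lborel (normal_density 0
       (sqrt (\<nu> * prob_space.expectation M (\<lambda>\<omega>. (l 1 1 \<omega>)\<^sup>2)
              / (1 - exciting_norm \<alpha> * prob_space.expectation M (l 1 1)) ^ 3))))"
proof -
  interpret marked_hawkes M \<nu> \<alpha> l Z X by (rule hawkes)
  note [measurable] = l_measurable[of 1 1, simplified]
  let ?\<mu> = mark_distribution
  define m\<^sub>1 where "m\<^sub>1 = (\<integral>\<omega>. l 1 1 \<omega> \<partial>M)"
  define m\<^sub>2 where "m\<^sub>2 = (\<integral>\<omega>. (l 1 1 \<omega>)\<^sup>2 \<partial>M)"
  have power: "(LINT x|?\<mu>. x ^ k) = (\<integral>\<omega>. l 1 1 \<omega> ^ k \<partial>M)" for k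
    by (simp add: mark_distribution_def integral_distr)
  have m: "(LINT x|?\<mu>. x) = m\<^sub>1" "(LINT x|?\<mu>. x\<^sup>2) = m\<^sub>2"
    using power[of 1] power[of 2] by (simp_all add: m\<^sub>1_def m\<^sub>2_def)
  define \<rho> where "\<rho> = exciting_norm \<alpha> * m\<^sub>1"
  have \<rho>: "\<rho> < 1" using stability by (simp add: \<rho>_def m\<^sub>1_def)
  interpret rec: cumulant_recursion \<alpha> \<Phi> m\<^sub>1 m\<^sub>2 "LINT x|?\<mu>. x ^ 3"
    unfolding m[symmetric]
  proof (rule mark.cumulant_recursion_laplace)
    show "integrable ?\<mu> (\<lambda>x. x ^ k)" if "k \<in> {1..3}" for k
      using moments[of 1 1 k] that by (simp add: mark_distribution_def integrable_distr_eq)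
    show "exciting_norm \<alpha> * (LINT x|?\<mu>. x) < 1" using \<rho> by (simp add: \<rho>_def m)
  qed (use norm_finite exciting_pos in \<open>auto intro: less_imp_le\<close>)
  \<comment> \<open>A positive variance makes the limit a genuine normal density; a vanishing second
    moment would force the almost surely positive mark to be 0.\<close>
  have m2_pos: "0 < m\<^sub>2"
  proof -
    have "m\<^sub>2 \<noteq> 0"
    proof
      assume "m\<^sub>2 = 0"
      then have "AE \<omega> in M. (l 1 1 \<omega>)\<^sup>2 = 0"
        using moments[of 1 1 2] unfolding m\<^sub>2_def by (subst (asm) integral_nonneg_eq_0_iff_AE) auto
      moreover have "AE \<omega> in M. 0 < l 1 1 \<omega>" by (rule marks_pos) simp_all
      ultimately have "AE \<omega> in M. False" by eventually_elim simp
      then show False by simp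
    qed
    then show ?thesis using rec.m2 by simp
  qed
  define \<sigma> where "\<sigma> = sqrt (\<nu> * m\<^sub>2 / (1 - \<rho>) ^ 3)"
  have \<sigma>: "0 < \<sigma>" "\<sigma>\<^sup>2 = \<nu> * m\<^sub>2 / (1 - \<rho>) ^ 3"
    using base_pos m2_pos \<rho> by (simp_all add: \<sigma>_def)
  define S where "S t \<omega> = 1 / sqrt (real t) * (cumulative_marks X t \<omega> - \<nu> * m\<^sub>1 * real t / (1 - \<rho>))" for t \<omega>
  have S [measurable]: "S t \<in> borel_measurable M" for t unfolding S_def by measurable
  have "weak_conv_m (\<lambda>t. distr M borel (S t)) (density lborel (normal_density 0 \<sigma>))"
  proof (rule levy_continuity)
    show "real_distribution (distr M borel (S t))" for t by simp
    show "real_distribution (density lborel (normal_density 0 \<sigma>))"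
      using prob_space_normal_density[OF \<sigma>(1)]
      by (auto simp: real_distribution_def real_distribution_axioms_def)
    fix \<theta> :: real
    define w where "w t = \<i> * complex_of_real (\<theta> / sqrt (real t))" for t :: nat
    \<comment> \<open>Centring subtracts exactly the linear term of the exponent, so the
      characteristic function of \<open>S t\<close> is \<open>exp (of_real \<nu> * c t)\<close>
      without error, also at t = 0, where both are 1.\<close>
    define c where "c t = (\<Sum>n<t. \<Phi> (cumulant_seq \<alpha> \<Phi> (w t) n) - 1) - t * (m\<^sub>1 * w t) / (1 - \<rho>)" for t
    have "char (distr M borel (S t)) \<theta> = exp (of_real \<nu> * c t)" for t
    proof -
      have eq: "\<i> * complex_of_real (\<theta> * S t \<omega>)
          = w t * of_real (cumulative_marks X t \<omega>) - of_real \<nu> * (t * (m\<^sub>1 * w t) / (1 - \<rho>))" for \<omega>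
      proof -
        have "\<theta> * S t \<omega> = \<theta> / sqrt (real t) * (cumulative_marks X t \<omega> - \<nu> * m\<^sub>1 * real t / (1 - \<rho>))"
          by (simp add: S_def)
        then have "\<i> * complex_of_real (\<theta> * S t \<omega>)
            = w t * of_real (cumulative_marks X t \<omega> - \<nu> * m\<^sub>1 * real t / (1 - \<rho>))"
          by (simp only: w_def of_real_mult mult.assoc)
        then show ?thesis by (simp add: right_diff_distrib mult_ac)
      qed
      have "char (distr M borel (S t)) \<theta> = (\<integral>\<omega>. exp (\<i> * complex_of_real (\<theta> * S t \<omega>)) \<partial>M)"
        unfolding char_def by (subst integral_distr) simp_all
      also have "\<dots> = (\<integral>\<omega>. exp (w t * of_real (cumulative_marks X t \<omega>)) \<partial>M) / exp (of_real \<nu> * (t * (m\<^sub>1 * w t) / (1 - \<rho>)))"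
        unfolding eq exp_diff by (rule integral_divide_zero)
      also have "\<dots> = exp (of_real \<nu> * c t)"
        by (subst cumulative_transform) (simp_all add: w_def c_def exp_diff[symmetric] right_diff_distrib)
      finally show ?thesis .
    qed
    moreover have "c \<longlonglongrightarrow> of_real (- (m\<^sub>2 * \<theta>\<^sup>2 / (2 * (1 - \<rho>) ^ 3)))"
      using rec.cumulant_limit[of \<theta>] tail unfolding exciting_tail_def c_def w_def \<rho>_def by blast
    then have "(\<lambda>t. exp (of_real \<nu> * c t)) \<longlonglongrightarrow> exp (of_real \<nu> * of_real (- (m\<^sub>2 * \<theta>\<^sup>2 / (2 * (1 - \<rho>) ^ 3))))"
      by (intro tendsto_intros)
    moreover have "exp (of_real \<nu> * of_real (- (m\<^sub>2 * \<theta>\<^sup>2 / (2 * (1 - \<rho>) ^ 3)))) = char (density lborel (normal_density 0 \<sigma>)) \<theta>"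
      unfolding char_normal_distribution[OF \<sigma>(1)] \<sigma>(2) of_real_mult[symmetric] exp_of_real
      by (simp add: mult.commute)
    ultimately show "(\<lambda>t. char (distr M borel (S t)) \<theta>) \<longlonglongrightarrow> char (density lborel (normal_density 0 \<sigma>)) \<theta>"
      by simp
  qed
  then show ?thesis unfolding S_def \<sigma>_def \<rho>_def m\<^sub>1_def m\<^sub>2_def .
qed

end
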